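(* For every $\epsilon>0$ there is a constant $c_\epsilon>0$ such that for each $q>1$ $$\#T_3([0,q]^3\cap\mathbb{Z}^3)\ge c_\epsilon\, q^{9-\epsilon}.$$
   Context: $T_3([0,q]^3\cap\mathbb{Z}^3)$ denotes the collection of all equivalence classes, under congruence, of (non-degenerate) tetrahedra with all four vertices in $[0,q]^3\cap\mathbb{Z}^3$. A tetrahedron is non-degenerate if its four vertices are affinely independent (equivalently, after translating one vertex to the origin, the other three vertices are linearly independent vectors). Two tetrahedra are congruent if some isometry of $\mathbb{R}^3$ maps one onto the other. $\#S$ denotes the cardinality of a set $S$. The constant $c_\epsilon$ depends only on $\epsilon$, not on $q$. *)

theory Defs
  imports "HOL-Analysis.Analysis"
begin

definition lattice_cube :: "real \<Rightarrow> (real ^ 3) set" where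
  "lattice_cube q = {x. \<forall>i. 0 \<le> x $ i \<and> x $ i \<le> q \<and> x $ i \<in> \<int>}"

text \<open>A tetrahedron is the solid body, i.e. the convex hull of its vertices.\<close>

definition tetrahedra :: "(real ^ 3) set \<Rightarrow> (real ^ 3) set set" where
  "tetrahedra E = {convex hull V |V. V \<subseteq> E \<and> card V = 4 \<and> \<not> affine_dependent V}"

definition congruent_sets :: "('a::metric_space) set \<Rightarrow> 'a set \<Rightarrow> bool" where
  "congruent_sets S T \<longleftrightarrow> (\<exists>f. (\<forall>x y. dist (f x) (f y) = dist x y) \<and> f ` S = T)"

text \<open>Surjectivity of the isometry is not required in the definition above, but it is automatic in
  \<open>real ^ 3\<close>, so that congruence is symmetric there.\<close>

definition congruence_on :: "(real ^ 3) set set \<Rightarrow> ((real ^ 3) set \<times> (real ^ 3) set) set" where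
  "congruence_on A = {(S, T). S \<in> A \<and> T \<in> A \<and> congruent_sets S T}"

definition T3 :: "(real ^ 3) set \<Rightarrow> (real ^ 3) set set set" where
  "T3 E = tetrahedra E // congruence_on (tetrahedra E)"

lemma congruent_sets_sym:
  fixes S T :: "(real ^ 3) set"
  assumes "congruent_sets S T"
  shows "congruent_sets T S"
proof -
  obtain f where iso: "\<And>x y. dist (f x) (f y) = dist x y" and img: "f ` S = T"
    using assms by (auto simp: congruent_sets_def)
  define g where "g x = f x - f 0" for x
  have "dist (g x) (g y) = dist x y" for x y
    using iso[of x y] by (simp add: g_def dist_norm)
  then have "orthogonal_transformation g"
    by (simp add: orthogonal_transformation_isometry g_def)
  then have "surj g"
    by (rule orthogonal_transformation_surj)
  have "surj f"
  proof (rule surjI)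
    fix y
    have "g (inv g (y - f 0)) = y - f 0"
      by (simp add: \<open>surj g\<close> surj_f_inv_f)
    then show "f (inv g (y - f 0)) = y"
      by (simp add: g_def)
  qed
  then have right: "f (inv f y) = y" for y
    by (simp add: surj_f_inv_f)
  have "inj f"
    by (metis injI iso dist_eq_0_iff)
  have "dist (inv f x) (inv f y) = dist x y" for x y
    by (metis iso right)
  moreover have "inv f ` T = S"
    using img \<open>inj f\<close> by (auto simp: image_image)
  ultimately show ?thesis
    unfolding congruent_sets_def by blast
qed

lemma equiv_congruence_on: "equiv A (congruence_on A)"
proof (rule equivI)
  show "congruence_on A \<subseteq> A \<times> A"
    by (auto simp: congruence_on_def)
  show "refl_on A (congruence_on A)"
    by (auto simp: congruence_on_def refl_on_def congruent_sets_def intro: exI[of _ id])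
  show "sym (congruence_on A)"
    by (auto simp: congruence_on_def sym_def congruent_sets_sym)
  show "trans (congruence_on A)"
  proof (rule transI)
    fix S T U
    assume "(S, T) \<in> congruence_on A" "(T, U) \<in> congruence_on A"
    then obtain f g where "S \<in> A" "U \<in> A"
      and "\<And>x y. dist (f x) (f y) = dist x y" "f ` S = T"
      and "\<And>x y. dist (g x) (g y) = dist x y" "g ` T = U"
      by (auto simp: congruence_on_def congruent_sets_def)
    then show "(S, U) \<in> congruence_on A"
      by (auto simp: congruence_on_def congruent_sets_def intro!: exI[of _ "g \<circ> f"])
  qed
qed

lemma finite_lattice_cube: "finite (lattice_cube q)"
proof -
  have "lattice_cube q \<subseteq> (\<lambda>h. \<chi> i. real_of_int (h i)) ` (UNIV \<rightarrow>\<^sub>E {0..\<lfloor>q\<rfloor>})"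
  proof
    fix x assume "x \<in> lattice_cube q"
    then have x: "0 \<le> x $ i" "x $ i \<le> q" "x $ i \<in> \<int>" for i
      by (auto simp: lattice_cube_def)
    show "x \<in> (\<lambda>h. \<chi> i. real_of_int (h i)) ` (UNIV \<rightarrow>\<^sub>E {0..\<lfloor>q\<rfloor>})"
      using x by (intro image_eqI[of _ _ "\<lambda>i. \<lfloor>x $ i\<rfloor>"])
        (auto simp: vec_eq_iff floor_mono)
  qed
  then show ?thesis
    by (rule finite_subset) (intro finite_imageI finite_PiE, auto)
qed

text \<open>In particular \<open>card (T3 (lattice_cube q))\<close> is a genuine cardinality.\<close>

lemma finite_T3:
  assumes "finite E"
  shows "finite (T3 E)"
proof -
  have "tetrahedra E \<subseteq> (\<lambda>V. convex hull V) ` Pow E"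
    by (auto simp: tetrahedra_def)
  then have "finite (tetrahedra E)"
    by (rule finite_subset) (simp add: assms)
  then show ?thesis
    unfolding T3_def by (rule finite_quotient) (auto simp: congruence_on_def)
qed

end

theory Submission
  imports Defs
begin

text \<open>
  Put one vertex of the tetrahedron at the origin, so that it is described by a triple of linearly
  independent integer vectors. There are of the order of \<open>q\<^sup>9\<close> such triples in the cube, and the
  congruence class of the tetrahedron fixes the Gram matrix of the triple up to boundedly many
  choices. By Cauchy-Schwarz it is therefore enough that only \<open>O(n\<^sup>9)\<close> pairs of triples with entries
  in \<open>[-n, n]\<close> have the same Gram matrix (\<open>card_gram_pairs_le\<close>): pairs are then
  no more frequent, up to a constant, than the triples themselves.

  Two triples with the same Gram matrix differ by an orthogonal map, which is rational. After
  changing the signs of some coordinates of one triple it is a rotation that has a Cayley transform,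
  and so it is the rotation of a primitive integer quaternion \<open>p\<close>
  (\<open>same_gram_rational_isometry\<close>). Let \<open>d\<close> be the norm of \<open>p\<close>. The integer vectors that this
  rotation sends to integer vectors form a lattice of index at least \<open>d / 4\<close> in \<open>\<int>\<^sup>3\<close>
  (\<open>qnorm_dvd_four_index\<close>). If that lattice has three independent vectors in the box of size \<open>n\<close>,
  then it has only \<open>O(n\<^sup>3 / d)\<close> points there (\<open>card_coincidence_lattice_le\<close>), hence \<open>O(n\<^sup>9 / d\<^sup>3)\<close>
  triples; and the second triple of a pair is recovered from the first, \<open>p\<close> and the signs. Since
  \<open>d\<^sup>3\<close> is the sixth power of the length of \<open>p\<close> in the four-dimensional lattice \<open>\<int>\<^sup>4\<close>, the sum of
  \<open>1 / d\<^sup>3\<close> over all \<open>p\<close> converges (\<open>sum_inverse_qnorm_cubed_bounded\<close>), which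
  gives the bound on pairs.

  The outcome is the lower bound \<open>c q\<^sup>9\<close>, which dominates \<open>c q\<^bsup>9-\<epsilon>\<^esup>\<close> because \<open>q > 1\<close>.
\<close>

section \<open>Integer vectors in three dimensions\<close>

type_synonym int3 = "int \<times> int \<times> int"

fun dot :: "int3 \<Rightarrow> int3 \<Rightarrow> int" where
  "dot (a, b, c) (x, y, z) = a * x + b * y + c * z"

fun cross :: "int3 \<Rightarrow> int3 \<Rightarrow> int3" where
  "cross (a, b, c) (x, y, z) = (b * z - c * y, c * x - a * z, a * y - b * x)"

fun scale :: "int \<Rightarrow> int3 \<Rightarrow> int3" where
  "scale k (x, y, z) = (k * x, k * y, k * z)"

definition det3 :: "int3 \<Rightarrow> int3 \<Rightarrow> int3 \<Rightarrow> int" where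
  "det3 u v w = dot u (cross v w)"

fun dvd3 :: "int \<Rightarrow> int3 \<Rightarrow> bool" where
  "dvd3 d (x, y, z) \<longleftrightarrow> d dvd x \<and> d dvd y \<and> d dvd z"

fun mod3 :: "int \<Rightarrow> int3 \<Rightarrow> int3" where
  "mod3 d (x, y, z) = (x mod d, y mod d, z mod d)"

text \<open>Expansion of \<open>x\<close> in the basis dual to \<open>u, v, w\<close>, with the denominator cleared so that everything
  stays integral.\<close>

lemma dual_basis_expansion:
  "scale (det3 u v w) x =
     scale (dot x u) (cross v w) + scale (dot x v) (cross w u) + scale (dot x w) (cross u v)"
  by (cases u; cases v; cases w; cases x) (simp add: det3_def algebra_simps)

lemma cramer3:
  "scale (det3 u v w) x = scale (det3 x v w) u + scale (det3 u x w) v + scale (det3 u v x) w"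
  by (cases u; cases v; cases w; cases x) (simp add: det3_def algebra_simps)

text \<open>If the \<open>y\<^sub>i\<close> form a basis, the hypotheses say that the linear map sending each \<open>y\<^sub>i\<close> to \<open>x\<^sub>i\<close>
  is skew-symmetric. A skew map of three-space is a cross product with a fixed vector; the point here is
  that the determinant of the \<open>y\<^sub>i\<close> suffices as a denominator for that vector.\<close>

lemma skew_map_is_cross_product:
  assumes "dot x1 y1 = 0" "dot x2 y2 = 0" "dot x3 y3 = 0"
    and "dot x1 y2 + dot x2 y1 = 0" "dot x1 y3 + dot x3 y1 = 0" "dot x2 y3 + dot x3 y2 = 0"
  obtains b where "scale (det3 y1 y2 y3) x1 = cross y1 b" "scale (det3 y1 y2 y3) x2 = cross y2 b"
    "scale (det3 y1 y2 y3) x3 = cross y3 b"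
proof
  (* The axial vector of the sum of the rank-one maps x_i (y_i^* . _), where y_i^* is the dual basis,
     is half of the sum of the x_i x y_i^*. Expanding the triple products and using skewness
     makes the terms coincide in pairs, which removes the half. *)
  let ?b = "scale (dot x1 y3) y2 + scale (dot x2 y1) y3 + scale (dot x3 y2) y1"
  have skew: "dot x1 y2 = - dot x2 y1" "dot x3 y1 = - dot x1 y3" "dot x2 y3 = - dot x3 y2"
    using assms by linarith+
  have expand: "cross y (scale k u + scale l v + scale m w) =
      scale k (cross y u) + scale l (cross y v) + scale m (cross y w)" for y u v w k l m
    by (cases y; cases u; cases v; cases w) (simp add: algebra_simps)
  have neg: "cross u v = - cross v u" "cross u u = 0" "scale k (- u) = - scale k u"
      "scale (- k) u = - scale k u" "scale 0 u = 0" "scale k 0 = 0" for k u v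
    by (cases u; cases v; simp add: zero_prod_def)+
  show "scale (det3 y1 y2 y3) x1 = cross y1 ?b"
    unfolding expand dual_basis_expansion assms(1) skew neg(2)
    by (subst neg(1)[of y1 y3]) (simp add: neg(2-) algebra_simps)
  show "scale (det3 y1 y2 y3) x2 = cross y2 ?b"
    unfolding expand dual_basis_expansion assms(2) skew neg(2)
    by (subst neg(1)[of y2 y1]) (simp add: neg(2-) algebra_simps)
  show "scale (det3 y1 y2 y3) x3 = cross y3 ?b"
    unfolding expand dual_basis_expansion assms(3) skew neg(2)
    by (subst neg(1)[of y3 y2]) (simp add: neg(2-) algebra_simps)
qed

section \<open>Rotations given by integer quaternions\<close>

fun qnorm :: "int \<times> int3 \<Rightarrow> int" where
  "qnorm (a, b) = a\<^sup>2 + dot b b"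

text \<open>The Euler-Rodrigues formula: dividing the value by \<open>qnorm (a, b)\<close> gives the rotation
  by the quaternion with real part \<open>a\<close> and imaginary part \<open>b\<close>.\<close>

fun euler_rodrigues :: "int \<times> int3 \<Rightarrow> int3 \<Rightarrow> int3" where
  "euler_rodrigues (a, b) v =
     scale (a\<^sup>2 - dot b b) v + scale (2 * dot b v) b - scale (2 * a) (cross v b)"

text \<open>The hypothesis is the Cayley form \<open>(1 - K) v = (1 + K) v'\<close> of a rotation, with \<open>K\<close> the cross
  product with \<open>b / a\<close>. Taking the inner product with \<open>b\<close> shows that \<open>b\<close> is the axis, and then the
  equation can be solved for \<open>v'\<close>.\<close>

lemma cayley_relation_solved:
  assumes "a \<noteq> 0" and rel: "scale a (v - v') = cross (v + v') b"
  shows "scale (qnorm (a, b)) v' = euler_rodrigues (a, b) v"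
proof -
  obtain b1 b2 b3 v1 v2 v3 w1 w2 w3
    where eq: "b = (b1, b2, b3)" "v = (v1, v2, v3)" "v' = (w1, w2, w3)"
    by (metis prod.exhaust)
  have r: "a * (v1 - w1) = (v2 + w2) * b3 - (v3 + w3) * b2"
     "a * (v2 - w2) = (v3 + w3) * b1 - (v1 + w1) * b3"
     "a * (v3 - w3) = (v1 + w1) * b2 - (v2 + w2) * b1"
    using rel by (simp_all add: eq)
  have "a * (b1 * v1 + b2 * v2 + b3 * v3) = a * (b1 * w1 + b2 * w2 + b3 * w3)"
    using r by algebra
  then have "b1 * v1 + b2 * v2 + b3 * v3 = b1 * w1 + b2 * w2 + b3 * w3"
    using \<open>a \<noteq> 0\<close> by simp
  with r show ?thesis
    by (simp add: eq power2_eq_square) algebra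
qed

fun primitive :: "int \<times> int3 \<Rightarrow> bool" where
  "primitive (a, b1, b2, b3) \<longleftrightarrow> gcd (gcd a b1) (gcd b2 b3) = 1"

lemma primitive_rescaling:
  assumes "a \<noteq> 0"
  obtains g a' b' where "g \<noteq> 0" "a = g * a'" "b = scale g b'" "primitive (a', b')"
proof -
  obtain b1 b2 b3 where b: "b = (b1, b2, b3)"
    by (metis prod.exhaust)
  define g where "g = gcd (gcd a b1) (gcd b2 b3)"
  have "g \<noteq> 0" "g > 0"
    using assms by (auto simp: g_def)
  have "g dvd a" "g dvd b1" "g dvd b2" "g dvd b3"
    unfolding g_def by (meson dvd_trans gcd_dvd1 gcd_dvd2)+
  then obtain a' c1 c2 c3 where c: "a = g * a'" "b1 = g * c1" "b2 = g * c2" "b3 = g * c3"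
    by (auto simp: dvd_def)
  have "g * 1 = g * gcd (gcd a' c1) (gcd c2 c3)"
    using g_def \<open>g > 0\<close> unfolding c by (simp add: gcd_mult_distrib_int[symmetric] abs_mult)
  then have "primitive (a', c1, c2, c3)"
    using \<open>g \<noteq> 0\<close> by simp
  then show thesis
    using that[of g a' "(c1, c2, c3)"] \<open>g \<noteq> 0\<close> c b by simp
qed

lemma primitive_dvd:
  assumes "primitive (a, b1, b2, b3)" "d dvd m * a" "d dvd m * b1" "d dvd m * b2" "d dvd m * b3"
  shows "d dvd m"
proof -
  have "d dvd gcd (gcd (m * a) (m * b1)) (gcd (m * b2) (m * b3))"
    using assms by simp
  also have "\<dots> = \<bar>m\<bar> * gcd (gcd a b1) (gcd b2 b3)"
    by (simp add: gcd_mult_distrib_int[symmetric] abs_mult)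
  finally show ?thesis
    using assms(1) by simp
qed

lemma scale_add_right: "scale k (v + w) = scale k v + scale k w"
  by (cases v; cases w) (simp add: distrib_left)

lemma scale_add_left: "scale (k + l) v = scale k v + scale l v"
  by (cases v) (simp add: distrib_right)

lemma scale_scale: "scale k (scale l v) = scale (k * l) v"
  by (cases v) (simp add: mult.assoc)

lemma scale_diff_right: "scale k (v - w) = scale k v - scale k w"
  by (cases v; cases w) (simp add: right_diff_distrib)

lemma dot_add_right: "dot b (v + w) = dot b v + dot b w"
  by (cases b; cases v; cases w) (simp add: distrib_left)

lemma dot_scale_right: "dot b (scale k v) = k * dot b v"
  by (cases b; cases v) (simp add: algebra_simps)

lemma cross_add_left: "cross (v + w) b = cross v b + cross w b"
  by (cases b; cases v; cases w) (simp add: algebra_simps)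

lemma cross_scale_left: "cross (scale k v) b = scale k (cross v b)"
  by (cases b; cases v) (simp add: algebra_simps)

lemma euler_rodrigues_add:
  "euler_rodrigues p (v + w) = euler_rodrigues p v + euler_rodrigues p w"
  by (cases p)
    (simp add: scale_add_right scale_add_left dot_add_right cross_add_left distrib_left distrib_right)

lemma euler_rodrigues_scale:
  "euler_rodrigues p (scale k v) = scale k (euler_rodrigues p v)"
  by (cases p)
    (simp add: scale_add_right scale_diff_right scale_scale dot_scale_right cross_scale_left ac_simps)

lemma dvd3_add: "dvd3 d v \<Longrightarrow> dvd3 d w \<Longrightarrow> dvd3 d (v + w)"
  by (cases v; cases w) simp

lemma dvd3_scale: "dvd3 d v \<Longrightarrow> dvd3 d (scale k v)"
  by (cases v) simp

lemma mod3_eq_iff: "mod3 d v = mod3 d w \<longleftrightarrow> dvd3 d (v - w)"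
  by (cases v; cases w) (simp add: mod_eq_dvd_iff)

section \<open>The coincidence lattice of a rational rotation\<close>

definition residues3 :: "int \<Rightarrow> (int3 \<Rightarrow> int3) \<Rightarrow> int3 set" where
  "residues3 d f = range (\<lambda>v. mod3 d (f v))"

lemma finite_residues3:
  assumes "d > 0"
  shows "finite (residues3 d f)"
proof (rule finite_subset)
  show "residues3 d f \<subseteq> {0..<d} \<times> {0..<d} \<times> {0..<d}"
  proof
    fix h
    assume "h \<in> residues3 d f"
    then obtain v where "h = mod3 d (f v)"
      by (auto simp: residues3_def)
    then show "h \<in> {0..<d} \<times> {0..<d} \<times> {0..<d}"
      using assms by (cases "f v") simp
  qed
qed auto

text \<open>Lagrange's theorem for the finite group of residues: translation by the residue of \<open>f v\<close> permutes
  the group, so the sum of all its elements does not change when each of them is shifted by \<open>f v\<close>.\<close>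

lemma card_residues3_annihilates:
  assumes "d > 0" and add: "\<And>v w. f (v + w) = f v + f w"
  shows "dvd3 d (scale (int (card (residues3 d f))) (f v))"
proof -
  let ?G = "residues3 d f"
  let ?s = "\<lambda>h. mod3 d (h + f v)"
  have fin: "finite ?G"
    using assms(1) by (rule finite_residues3)
  have mm: "mod3 d (mod3 d x + y) = mod3 d (x + y)" for x y
    by (cases x; cases y) (simp add: mod_simps)
  have "inj_on ?s ?G"
  proof (rule inj_onI)
    fix g h
    assume "g \<in> ?G" "h \<in> ?G" and "?s g = ?s h"
    then have "mod3 d g = mod3 d h"
      by (simp add: mod3_eq_iff)
    moreover have "mod3 d (mod3 d x) = mod3 d x" for x
      by (cases x) simp
    ultimately show "g = h"
      using \<open>g \<in> ?G\<close> \<open>h \<in> ?G\<close> unfolding residues3_def by fastforce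
  qed
  moreover have "?s ` ?G \<subseteq> ?G"
    by (auto simp: residues3_def mm add[symmetric])
  ultimately have bij: "bij_betw ?s ?G ?G"
    using fin by (simp add: bij_betw_def endo_inj_surj)
  have "d dvd int (card ?G) * c (f v)"
    if cadd: "\<And>x y. c (x + y) = c x + c y" and cmod: "\<And>x. c (mod3 d x) = c x mod d" for c
  proof -
    have "(\<Sum>h\<in>?G. c h) = (\<Sum>h\<in>?G. (c h + c (f v)) mod d)"
      using sum.reindex_bij_betw[OF bij, of c] by (simp add: cadd cmod)
    then have "(\<Sum>h\<in>?G. c h) mod d = ((\<Sum>h\<in>?G. c h) + int (card ?G) * c (f v)) mod d"
      by (simp add: mod_sum_eq sum.distrib)
    then have "d dvd (\<Sum>h\<in>?G. c h) - ((\<Sum>h\<in>?G. c h) + int (card ?G) * c (f v))"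
      by (simp only: mod_eq_dvd_iff)
    then show ?thesis
      by simp
  qed
  note this[of fst] this[of "\<lambda>x. fst (snd x)"] this[of "\<lambda>x. snd (snd x)"]
  moreover have "fst (mod3 d x) = fst x mod d" "fst (snd (mod3 d x)) = fst (snd x) mod d"
    "snd (snd (mod3 d x)) = snd (snd x) mod d" for x
    by (cases x; simp)+
  ultimately show ?thesis
    by (cases "f v") simp
qed

text \<open>The kernel of \<open>euler_rodrigues p\<close> modulo \<open>d = qnorm p\<close> is the lattice of integer vectors with
  integer image, so the number \<open>m\<close> of residues is its index in \<open>\<int>\<^sup>3\<close>. As \<open>m\<close> kills
  the residues, \<open>d\<close> divides \<open>m\<close> times every matrix entry. Suitable combinations of the
  entries and \<open>d\<close> are \<open>4 x y\<close> for any two coordinates \<open>x, y\<close> of \<open>p\<close>, and these products have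
  greatest common divisor \<open>4\<close> because \<open>p\<close> is primitive.\<close>

lemma qnorm_dvd_four_index:
  assumes "primitive p" "qnorm p > 0"
  shows "qnorm p dvd 4 * int (card (residues3 (qnorm p) (euler_rodrigues p)))"
proof -
  define m where "m = int (card (residues3 (qnorm p) (euler_rodrigues p)))"
  obtain a b1 b2 b3 where p: "p = (a, b1, b2, b3)"
    by (metis prod.exhaust)
  define d where "d = qnorm p"
  have d: "d = a\<^sup>2 + b1\<^sup>2 + b2\<^sup>2 + b3\<^sup>2"
    by (simp add: d_def p power2_eq_square)
  have "dvd3 d (scale m (euler_rodrigues p v))" for v
    unfolding m_def d_def by (rule card_residues3_annihilates) (simp_all add: assms euler_rodrigues_add)
  note this[of "(1, 0, 0)"] this[of "(0, 1, 0)"] this[of "(0, 0, 1)"]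
  then have "d dvd m * (a\<^sup>2 - (b1 * b1 + b2 * b2 + b3 * b3) + 2 * b1 * b1)"
      "d dvd m * (2 * b1 * b2 + 2 * a * b3)" "d dvd m * (2 * b1 * b3 - 2 * a * b2)"
      "d dvd m * (2 * b2 * b1 - 2 * a * b3)"
      "d dvd m * (a\<^sup>2 - (b1 * b1 + b2 * b2 + b3 * b3) + 2 * b2 * b2)"
      "d dvd m * (2 * b2 * b3 + 2 * a * b1)"
      "d dvd m * (2 * b3 * b1 + 2 * a * b2)" "d dvd m * (2 * b3 * b2 - 2 * a * b1)"
      "d dvd m * (a\<^sup>2 - (b1 * b1 + b2 * b2 + b3 * b3) + 2 * b3 * b3)"
    by (simp_all add: p)
  then obtain k11 k12 k13 k21 k22 k23 k31 k32 k33 where k: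
    "m * (a\<^sup>2 - (b1 * b1 + b2 * b2 + b3 * b3) + 2 * b1 * b1) = d * k11"
    "m * (2 * b1 * b2 + 2 * a * b3) = d * k12" "m * (2 * b1 * b3 - 2 * a * b2) = d * k13"
    "m * (2 * b2 * b1 - 2 * a * b3) = d * k21"
    "m * (a\<^sup>2 - (b1 * b1 + b2 * b2 + b3 * b3) + 2 * b2 * b2) = d * k22"
    "m * (2 * b2 * b3 + 2 * a * b1) = d * k23"
    "m * (2 * b3 * b1 + 2 * a * b2) = d * k31" "m * (2 * b3 * b2 - 2 * a * b1) = d * k32"
    "m * (a\<^sup>2 - (b1 * b1 + b2 * b2 + b3 * b3) + 2 * b3 * b3) = d * k33"
    by (elim dvdE) (rule that; assumption)
  have "(4 * m * b1) * b2 = d * (k12 + k21)" "(4 * m * b3) * a = d * (k12 - k21)"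
    "(4 * m * b1) * b3 = d * (k13 + k31)" "(4 * m * b2) * a = d * (k31 - k13)"
    "(4 * m * b2) * b3 = d * (k23 + k32)" "(4 * m * b1) * a = d * (k23 - k32)"
    unfolding distrib_left right_diff_distrib k[symmetric] by algebra+
  then have off: "d dvd (4 * m * b1) * b2" "d dvd (4 * m * b3) * a" "d dvd (4 * m * b1) * b3"
    "d dvd (4 * m * b2) * a" "d dvd (4 * m * b2) * b3" "d dvd (4 * m * b1) * a"
    by simp_all
  have dm: "d * m = (a\<^sup>2 + b1\<^sup>2 + b2\<^sup>2 + b3\<^sup>2) * m"
    by (simp add: d)
  have "(4 * m * a) * a = d * (m + k11 + k22 + k33)" "(4 * m * b1) * b1 = d * (m + k11 - k22 - k33)"
     "(4 * m * b2) * b2 = d * (m - k11 + k22 - k33)" "(4 * m * b3) * b3 = d * (m - k11 - k22 + k33)"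
    unfolding distrib_left right_diff_distrib k[symmetric] dm by algebra+
  then have diag: "d dvd (4 * m * a) * a" "d dvd (4 * m * b1) * b1" "d dvd (4 * m * b2) * b2"
    "d dvd (4 * m * b3) * b3"
    by simp_all
  have dv: "d dvd (4 * m * x) * y" if "x \<in> {a, b1, b2, b3}" "y \<in> {a, b1, b2, b3}" for x y
    using off[unfolded mult.assoc] diag[unfolded mult.assoc] that
    by (elim insertE emptyE) (simp_all only: mult.assoc mult.commute mult.left_commute)
  have *: "d dvd 4 * m * x" if "x \<in> {a, b1, b2, b3}" for x
    by (rule primitive_dvd[OF assms(1)[unfolded p]]; rule dv[OF that]; simp)
  have "d dvd 4 * m"
    by (rule primitive_dvd[OF assms(1)[unfolded p]]; rule *; simp)
  then show ?thesis
    by (simp add: d_def m_def)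
qed

definition box3 :: "int \<Rightarrow> int3 set" where
  "box3 R = {- R..R} \<times> {- R..R} \<times> {- R..R}"

lemma finite_box3 [simp]: "finite (box3 R)"
  by (simp add: box3_def)

lemma card_box3: "R \<ge> 0 \<Longrightarrow> int (card (box3 R)) = (2 * R + 1) ^ 3"
  by (simp add: box3_def card_cartesian_product power3_eq_cube)

lemma box3_add: "v \<in> box3 R \<Longrightarrow> w \<in> box3 S \<Longrightarrow> v + w \<in> box3 (R + S)"
  by (cases v; cases w) (simp add: box3_def)

text \<open>Every integer vector can be moved into a fixed box by vectors of the lattice spanned by \<open>e1, e2, e3\<close>:
  round down its coefficients with respect to that basis, which Cramer's rule expresses as quotients
  by the determinant.\<close>

lemma reduce_modulo_basis:
  assumes nz: "det3 e1 e2 e3 \<noteq> 0" and e: "e1 \<in> box3 R" "e2 \<in> box3 R" "e3 \<in> box3 R"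
  obtains c1 c2 c3 where "v - (scale c1 e1 + scale c2 e2 + scale c3 e3) \<in> box3 (3 * R)"
proof
  let ?D = "det3 e1 e2 e3"
  let ?a = "det3 v e2 e3" and ?b = "det3 e1 v e3" and ?c = "det3 e1 e2 v"
  have small: "\<bar>x\<bar> \<le> 3 * R"
    if eq: "?D * v0 = ?a * x1 + ?b * x2 + ?c * x3"
      and x: "x = v0 - (?a div ?D * x1 + ?b div ?D * x2 + ?c div ?D * x3)"
      and b: "\<bar>x1\<bar> \<le> R" "\<bar>x2\<bar> \<le> R" "\<bar>x3\<bar> \<le> R" for x v0 x1 x2 x3
  proof -
    have "?D * x = (?a - ?D * (?a div ?D)) * x1 + (?b - ?D * (?b div ?D)) * x2
        + (?c - ?D * (?c div ?D)) * x3"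
      unfolding x right_diff_distrib eq by (simp add: algebra_simps)
    also have "\<dots> = ?a mod ?D * x1 + ?b mod ?D * x2 + ?c mod ?D * x3"
      by (simp add: minus_mult_div_eq_mod)
    finally have "\<bar>?D\<bar> * \<bar>x\<bar> = \<bar>?a mod ?D * x1 + ?b mod ?D * x2 + ?c mod ?D * x3\<bar>"
      by (simp add: abs_mult[symmetric])
    also have "\<dots> \<le> \<bar>?a mod ?D * x1\<bar> + \<bar>?b mod ?D * x2\<bar> + \<bar>?c mod ?D * x3\<bar>"
      by linarith
    also have "\<dots> \<le> \<bar>?D\<bar> * R + \<bar>?D\<bar> * R + \<bar>?D\<bar> * R"
      unfolding abs_mult
      by (intro add_mono mult_mono b less_imp_le[OF abs_mod_less[OF nz]]) auto
    finally have "\<bar>?D\<bar> * \<bar>x\<bar> \<le> \<bar>?D\<bar> * (3 * R)"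
      by (simp add: mult_ac)
    then show ?thesis
      using nz by (simp add: mult_le_cancel_left_pos)
  qed
  obtain x1 y1 z1 x2 y2 z2 x3 y3 z3 x y z
    where eq: "e1 = (x1, y1, z1)" "e2 = (x2, y2, z2)" "e3 = (x3, y3, z3)" "v = (x, y, z)"
    by (metis prod.exhaust)
  have "scale ?D v = scale ?a e1 + scale ?b e2 + scale ?c e3"
    by (rule cramer3)
  moreover have "scale k e1 = (k * x1, k * y1, k * z1)" "scale k e2 = (k * x2, k * y2, k * z2)"
    "scale k e3 = (k * x3, k * y3, k * z3)" "scale k v = (k * x, k * y, k * z)" for k
    by (simp_all add: eq)
  ultimately have D: "?D * x = ?a * x1 + ?b * x2 + ?c * x3" "?D * y = ?a * y1 + ?b * y2 + ?c * y3"
    "?D * z = ?a * z1 + ?b * z2 + ?c * z3"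
    by simp_all
  have b: "\<bar>x1\<bar> \<le> R" "\<bar>x2\<bar> \<le> R" "\<bar>x3\<bar> \<le> R" "\<bar>y1\<bar> \<le> R" "\<bar>y2\<bar> \<le> R" "\<bar>y3\<bar> \<le> R"
    "\<bar>z1\<bar> \<le> R" "\<bar>z2\<bar> \<le> R" "\<bar>z3\<bar> \<le> R"
    using e by (auto simp: eq box3_def)
  define ka kb kc where k: "ka = ?a div ?D" "kb = ?b div ?D" "kc = ?c div ?D"
  have "\<bar>x - (ka * x1 + kb * x2 + kc * x3)\<bar> \<le> 3 * R"
    "\<bar>y - (ka * y1 + kb * y2 + kc * y3)\<bar> \<le> 3 * R"
    "\<bar>z - (ka * z1 + kb * z2 + kc * z3)\<bar> \<le> 3 * R"
    unfolding k by (intro small[OF D(1) refl] small[OF D(2) refl] small[OF D(3) refl] b)+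
  then have "v - (scale ka e1 + scale kb e2 + scale kc e3) \<in> box3 (3 * R)"
    by (simp add: eq box3_def abs_le_iff)
  then show "v - (scale (?a div ?D) e1 + scale (?b div ?D) e2 + scale (?c div ?D) e3) \<in> box3 (3 * R)"
    by (simp only: k)
qed

text \<open>The integer vectors whose image under the rotation of \<open>p\<close> is again integral, known in
  crystallography as the coincidence site lattice.\<close>

definition coincidence_lattice :: "int \<times> int3 \<Rightarrow> int3 set" where
  "coincidence_lattice p = {v. dvd3 (qnorm p) (euler_rodrigues p v)}"

lemma coincidence_lattice_add:
  "v \<in> coincidence_lattice p \<Longrightarrow> w \<in> coincidence_lattice p \<Longrightarrow> v + w \<in> coincidence_lattice p"
  by (simp add: coincidence_lattice_def euler_rodrigues_add dvd3_add)

lemma coincidence_lattice_scale: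
  "v \<in> coincidence_lattice p \<Longrightarrow> scale k v \<in> coincidence_lattice p"
  by (simp add: coincidence_lattice_def euler_rodrigues_scale dvd3_scale)

text \<open>A basis of short lattice vectors provides every residue class with a representative in the box of
  size \<open>3 R\<close>. The translates of the lattice points of the small box by these representatives are
  pairwise distinct integer points of the box of size \<open>4 R\<close>.\<close>

lemma coincidence_lattice_packing:
  fixes R :: int
  assumes p: "qnorm p > 0" and nz: "det3 e1 e2 e3 \<noteq> 0"
    and e: "{e1, e2, e3} \<subseteq> coincidence_lattice p \<inter> box3 R"
  shows "card (coincidence_lattice p \<inter> box3 R) * card (residues3 (qnorm p) (euler_rodrigues p))
    \<le> card (box3 (4 * R))"
proof -
  let ?d = "qnorm p" and ?f = "euler_rodrigues p" and ?L = "coincidence_lattice p"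
  have shift: "mod3 ?d (?f (v + w)) = mod3 ?d (?f v)" if "w \<in> ?L" for v w
    using that by (simp add: mod3_eq_iff euler_rodrigues_add coincidence_lattice_def)
  have "\<exists>r. r \<in> box3 (3 * R) \<and> mod3 ?d (?f r) = g" if g: "g \<in> residues3 ?d ?f" for g
  proof -
    obtain v where v: "g = mod3 ?d (?f v)"
      using g by (auto simp: residues3_def)
    obtain c1 c2 c3 where c: "v - (scale c1 e1 + scale c2 e2 + scale c3 e3) \<in> box3 (3 * R)"
      using reduce_modulo_basis[OF nz, of R v] e by auto
    have "scale c1 e1 + scale c2 e2 + scale c3 e3 \<in> ?L"
      using e by (intro coincidence_lattice_add coincidence_lattice_scale) auto
    from shift[OF this, of "v - (scale c1 e1 + scale c2 e2 + scale c3 e3)"] show ?thesis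
      using c v by (intro exI conjI) auto
  qed
  then obtain r where r: "\<And>g. g \<in> residues3 ?d ?f \<Longrightarrow> r g \<in> box3 (3 * R)"
      "\<And>g. g \<in> residues3 ?d ?f \<Longrightarrow> mod3 ?d (?f (r g)) = g"
    by metis
  let ?h = "\<lambda>(x, g). r g + x"
  have "inj_on ?h ((?L \<inter> box3 R) \<times> residues3 ?d ?f)"
  proof (rule inj_onI, unfold mem_Sigma_iff split_paired_all prod.case Int_iff, elim conjE)
    fix x g x' g'
    assume *: "x \<in> ?L" "x' \<in> ?L" "g \<in> residues3 ?d ?f" "g' \<in> residues3 ?d ?f"
      and eq: "r g + x = r g' + x'"
    have "mod3 ?d (?f (r g)) = mod3 ?d (?f (r g'))"
      using shift[OF *(1), of "r g"] shift[OF *(2), of "r g'"] eq by simp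
    then have "g = g'"
      using * r by metis
    then show "(x, g) = (x', g')"
      using eq by simp
  qed
  moreover have "?h ` ((?L \<inter> box3 R) \<times> residues3 ?d ?f) \<subseteq> box3 (4 * R)"
  proof (rule image_subsetI)
    fix y
    assume "y \<in> (?L \<inter> box3 R) \<times> residues3 ?d ?f"
    then obtain x g where "y = (x, g)" "x \<in> box3 R" "g \<in> residues3 ?d ?f"
      by auto
    then show "?h y \<in> box3 (4 * R)"
      using box3_add[of "r g" "3 * R" x R] r by simp
  qed
  ultimately have "card ((?L \<inter> box3 R) \<times> residues3 ?d ?f) \<le> card (box3 (4 * R))"
    by (rule card_inj_on_le) simp
  then show ?thesis
    by (simp add: card_cartesian_product)
qed

lemma card_coincidence_lattice_le:
  assumes p: "primitive p" "qnorm p > 0" and nz: "det3 e1 e2 e3 \<noteq> 0"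
    and e: "{e1, e2, e3} \<subseteq> coincidence_lattice p \<inter> box3 R" and R: "R \<ge> 0"
  shows "int (card (coincidence_lattice p \<inter> box3 R)) * qnorm p \<le> 4 * (8 * R + 1) ^ 3"
proof -
  let ?G = "residues3 (qnorm p) (euler_rodrigues p)"
  have "?G \<noteq> {}"
    by (auto simp: residues3_def)
  then have "card ?G > 0"
    using finite_residues3[OF p(2)] by (simp add: card_gt_0_iff)
  then have "qnorm p \<le> 4 * int (card ?G)"
    using qnorm_dvd_four_index[OF p] by (intro zdvd_imp_le) auto
  then have "int (card (coincidence_lattice p \<inter> box3 R)) * qnorm p
      \<le> int (card (coincidence_lattice p \<inter> box3 R)) * (4 * int (card ?G))"
    by (intro mult_left_mono) auto
  also have "\<dots> = 4 * int (card (coincidence_lattice p \<inter> box3 R) * card ?G)"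
    by simp
  also have "\<dots> \<le> 4 * int (card (box3 (4 * R)))"
    using coincidence_lattice_packing[OF p(2) nz e] by (metis mult_left_mono of_nat_le_iff zero_le_numeral)
  also have "\<dots> = 4 * (8 * R + 1) ^ 3"
    using card_box3[of "4 * R"] R by simp
  finally show ?thesis .
qed

section \<open>Triples with the same Gram matrix\<close>

fun flip :: "int3 \<Rightarrow> int3 \<Rightarrow> int3" where
  "flip (s1, s2, s3) (x, y, z) = (s1 * x, s2 * y, s3 * z)"

definition signs :: "int3 set" where
  "signs = {-1, 1} \<times> {-1, 1} \<times> {-1, 1}"

lemma card_signs: "card signs = 8"
  by (simp add: signs_def card_cartesian_product)

lemma finite_signs: "finite signs"
  by (simp add: signs_def)

lemma dot_flip: "s \<in> signs \<Longrightarrow> dot (flip s v) (flip s w) = dot v w"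
  by (cases v; cases w) (auto simp: signs_def)

lemma flip_flip: "s \<in> signs \<Longrightarrow> flip s (flip s v) = v"
  by (cases v) (auto simp: signs_def)

text \<open>The determinant is affine in each of the three signs, so its average over all sign patterns is its
  value when the signs are replaced by zero. This is what makes the Cayley transform available: a
  rotation by a half-turn has eigenvalue \<open>-1\<close> and does not have one.\<close>

lemma exists_nonsingular_flip:
  assumes "det3 u v w \<noteq> 0"
  obtains s where "s \<in> signs" "det3 (u + flip s u') (v + flip s v') (w + flip s w') \<noteq> 0"
proof -
  let ?f = "\<lambda>s. det3 (u + flip s u') (v + flip s v') (w + flip s w')"
  have "?f (1, 1, 1) + ?f (1, 1, -1) + ?f (1, -1, 1) + ?f (1, -1, -1)
      + ?f (-1, 1, 1) + ?f (-1, 1, -1) + ?f (-1, -1, 1) + ?f (-1, -1, -1) = 8 * det3 u v w"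
    by (cases u; cases v; cases w; cases u'; cases v'; cases w') (simp add: det3_def algebra_simps)
  with assms have "\<not> (?f (1, 1, 1) = 0 \<and> ?f (1, 1, -1) = 0 \<and> ?f (1, -1, 1) = 0
      \<and> ?f (1, -1, -1) = 0 \<and> ?f (-1, 1, 1) = 0 \<and> ?f (-1, 1, -1) = 0 \<and> ?f (-1, -1, 1) = 0
      \<and> ?f (-1, -1, -1) = 0)"
    by linarith
  then show thesis
    using that by (auto simp: signs_def)
qed

fun same_gram :: "int3 \<times> int3 \<times> int3 \<Rightarrow> int3 \<times> int3 \<times> int3 \<Rightarrow> bool" where
  "same_gram (u, v, w) (u', v', w') \<longleftrightarrow>
     dot u u = dot u' u' \<and> dot v v = dot v' v' \<and> dot w w = dot w' w' \<and>
     dot u v = dot u' v' \<and> dot u w = dot u' w' \<and> dot v w = dot v' w'"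

lemma qnorm_pos:
  assumes "primitive p"
  shows "qnorm p > 0"
proof -
  obtain a b1 b2 b3 where p: "p = (a, b1, b2, b3)"
    by (metis prod.exhaust)
  have "a \<noteq> 0 \<or> b1 \<noteq> 0 \<or> b2 \<noteq> 0 \<or> b3 \<noteq> 0"
    using assms by (auto simp: p)
  moreover have "x\<^sup>2 > 0" if "x \<noteq> 0" for x :: int
    using that by simp
  moreover have "a\<^sup>2 \<ge> 0" "b1\<^sup>2 \<ge> 0" "b2\<^sup>2 \<ge> 0" "b3\<^sup>2 \<ge> 0"
    by simp_all
  moreover have "qnorm p = a\<^sup>2 + b1\<^sup>2 + b2\<^sup>2 + b3\<^sup>2"
    by (simp add: p power2_eq_square)
  ultimately show ?thesis
    by (smt (verit))
qed

lemma cross_scale_right: "cross v (scale k b) = scale k (cross v b)"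
  by (cases b; cases v) (simp add: algebra_simps)

lemma scale_cancel: "k \<noteq> 0 \<Longrightarrow> scale k v = scale k w \<longleftrightarrow> v = w"
  by (cases v; cases w) auto

text \<open>If \<open>v\<close> and \<open>v'\<close> run through two triples with the same Gram matrix, then polarisation shows that
  \<open>v + v'\<close> is sent to \<open>v - v'\<close> by a skew map. It is a cross product by
  \<open>skew_map_is_cross_product\<close>, which is the Cayley form of a rotation taking the one triple to the
  other.\<close>

lemma same_gram_rational_isometry:
  assumes nz: "det3 u v w \<noteq> 0" and gram: "same_gram (u, v, w) (u', v', w')"
  obtains s p where "s \<in> signs" "primitive p"
    "scale (qnorm p) (flip s u') = euler_rodrigues p u"
    "scale (qnorm p) (flip s v') = euler_rodrigues p v"
    "scale (qnorm p) (flip s w') = euler_rodrigues p w"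
proof -
  obtain s where s: "s \<in> signs" and "det3 (u + flip s u') (v + flip s v') (w + flip s w') \<noteq> 0"
    using exists_nonsingular_flip[OF nz] .
  define x y z where "x = flip s u'" and "y = flip s v'" and "z = flip s w'"
  let ?D = "det3 (u + x) (v + y) (w + z)"
  have D: "?D \<noteq> 0"
    unfolding x_def y_def z_def by fact
  have polar: "dot (a - a') (c + c') + dot (c - c') (a + a') = 2 * (dot a c - dot a' c')"
    "dot (a - a') (a + a') = dot a a - dot a' a'" for a a' c c'
    by (cases a; cases a'; cases c; cases c'; simp add: algebra_simps)+
  have g: "dot u u = dot x x" "dot v v = dot y y" "dot w w = dot z z"
    "dot u v = dot x y" "dot u w = dot x z" "dot v w = dot y z"
    using gram by (simp_all add: x_def y_def z_def dot_flip[OF s])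
  obtain b where b: "scale ?D (u - x) = cross (u + x) b" "scale ?D (v - y) = cross (v + y) b"
    "scale ?D (w - z) = cross (w + z) b"
    by (rule skew_map_is_cross_product[of "u - x" "u + x" "v - y" "v + y" "w - z" "w + z"])
      (simp_all add: polar g)
  obtain h a c where h: "h \<noteq> 0" "?D = h * a" "b = scale h c" "primitive (a, c)"
    using primitive_rescaling[OF D] .
  have "a \<noteq> 0"
    using D h by auto
  have er: "scale (qnorm (a, c)) m' = euler_rodrigues (a, c) m"
    if "scale ?D (m - m') = cross (m + m') b" for m m'
  proof (rule cayley_relation_solved[OF \<open>a \<noteq> 0\<close>])
    show "scale a (m - m') = cross (m + m') c"
      using that h(1) unfolding h(2,3) by (simp add: cross_scale_right scale_scale[symmetric] scale_cancel)
  qed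
  show thesis
    using that[of s "(a, c)"] s h(4) er b unfolding x_def y_def z_def by blast
qed

text \<open>The quaternions whose coincidence lattice contains three independent vectors of the box: the only
  ones that can relate two nonsingular triples of the box.\<close>

definition full_rank_quaternions :: "int \<Rightarrow> (int \<times> int3) set" where
  "full_rank_quaternions R = {p. primitive p \<and> (\<exists>e1 e2 e3. det3 e1 e2 e3 \<noteq> 0 \<and>
     {e1, e2, e3} \<subseteq> coincidence_lattice p \<inter> box3 R)}"

lemma full_rank_quaternions_bounds:
  assumes "p \<in> full_rank_quaternions R" "R \<ge> 0"
  shows "int (card (coincidence_lattice p \<inter> box3 R)) * qnorm p \<le> 4 * (8 * R + 1) ^ 3"
    and "qnorm p > 0" and "qnorm p \<le> 4 * (8 * R + 1) ^ 3"
proof -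
  obtain e1 e2 e3 where p: "primitive p" and nz: "det3 e1 e2 e3 \<noteq> 0"
    and e: "{e1, e2, e3} \<subseteq> coincidence_lattice p \<inter> box3 R"
    using assms by (auto simp: full_rank_quaternions_def)
  show pos: "qnorm p > 0"
    by (rule qnorm_pos[OF p])
  show le: "int (card (coincidence_lattice p \<inter> box3 R)) * qnorm p \<le> 4 * (8 * R + 1) ^ 3"
    by (rule card_coincidence_lattice_le[OF p pos nz e assms(2)])
  have "card (coincidence_lattice p \<inter> box3 R) > 0"
    using e by (subst card_gt_0_iff) auto
  then have "1 * qnorm p \<le> int (card (coincidence_lattice p \<inter> box3 R)) * qnorm p"
    using pos by (intro mult_right_mono) auto
  with le show "qnorm p \<le> 4 * (8 * R + 1) ^ 3"
    by linarith
qed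

lemma coordinate_le_qnorm:
  assumes "qnorm (a, b1, b2, b3) > 0" and "x \<in> {a, b1, b2, b3}"
  shows "(1 + \<bar>x\<bar>)\<^sup>2 \<le> 4 * qnorm (a, b1, b2, b3)"
proof -
  have q: "qnorm (a, b1, b2, b3) = a\<^sup>2 + b1\<^sup>2 + b2\<^sup>2 + b3\<^sup>2"
    by (simp add: power2_eq_square)
  have le: "x\<^sup>2 \<le> qnorm (a, b1, b2, b3)"
    using assms(2) unfolding q by (auto simp: add_nonneg_nonneg)
  have "(1 + \<bar>x\<bar>)\<^sup>2 + (1 - \<bar>x\<bar>)\<^sup>2 = 2 + 2 * x\<^sup>2"
    by (simp add: power2_sum power2_diff)
  then have "(1 + \<bar>x\<bar>)\<^sup>2 \<le> 2 + 2 * x\<^sup>2"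
    using zero_le_power2[of "1 - \<bar>x\<bar>"] by linarith
  with le assms(1) show ?thesis
    by linarith
qed

lemma finite_full_rank_quaternions:
  assumes "R \<ge> 0"
  shows "finite (full_rank_quaternions R)"
proof (rule finite_subset)
  let ?N = "16 * (8 * R + 1) ^ 3"
  show "full_rank_quaternions R \<subseteq> {-?N..?N} \<times> {-?N..?N} \<times> {-?N..?N} \<times> {-?N..?N}"
  proof
    fix p
    assume p: "p \<in> full_rank_quaternions R"
    obtain a b1 b2 b3 where eq: "p = (a, b1, b2, b3)"
      by (metis prod.exhaust)
    have "\<bar>x\<bar> \<le> ?N" if "x \<in> {a, b1, b2, b3}" for x
    proof -
      have "\<bar>x\<bar> \<le> 1 + \<bar>x\<bar>" "1 + \<bar>x\<bar> \<le> (1 + \<bar>x\<bar>)\<^sup>2"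
        by (simp_all add: self_le_power)
      then show ?thesis
        using coordinate_le_qnorm[OF full_rank_quaternions_bounds(2)[OF p assms, unfolded eq] that]
          full_rank_quaternions_bounds(3)[OF p assms] unfolding eq by linarith
    qed
    then have "\<bar>a\<bar> \<le> ?N" "\<bar>b1\<bar> \<le> ?N" "\<bar>b2\<bar> \<le> ?N" "\<bar>b3\<bar> \<le> ?N"
      by blast+
    then show "p \<in> {-?N..?N} \<times> {-?N..?N} \<times> {-?N..?N} \<times> {-?N..?N}"
      unfolding eq by (simp add: abs_le_iff)
  qed
qed auto

section \<open>Convergence of the sum over quaternions\<close>

lemma sum_over_int_box_bounded:
  obtains C where "C > 0" "\<And>N. (\<Sum>n=-N..N. (1 + real_of_int \<bar>n\<bar>) powr (-3/2)) \<le> C"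
proof -
  define f :: "nat \<Rightarrow> real" where "f n = real (Suc n) powr (-3/2)" for n
  have "summable (\<lambda>n. real n powr (-3/2))"
    by (subst summable_real_powr_iff) simp
  then have "summable f"
    unfolding f_def by (subst summable_Suc_iff)
  then have le: "sum f {..m} \<le> suminf f" for m
    by (intro sum_le_suminf) (auto simp: f_def)
  have pos: "suminf f > 0"
    using le[of 0] by (simp add: f_def)
  show thesis
  proof (rule that[of "2 * suminf f"])
    fix N :: int
    let ?g = "\<lambda>n::int. (1 + real_of_int \<bar>n\<bar>) powr (-3/2)"
    have g: "?g (int m) = f m" "?g (- int m) = f m" for m
      by (simp_all add: f_def)
    have sub: "{-N..N} \<subseteq> int ` {..nat N} \<union> (\<lambda>m. - int m) ` {..nat N}"
    proof
      fix n :: int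
      assume "n \<in> {-N..N}"
      then show "n \<in> int ` {..nat N} \<union> (\<lambda>m. - int m) ` {..nat N}"
        by (cases n rule: int_cases2) auto
    qed
    have "sum ?g {-N..N} \<le> sum ?g (int ` {..nat N} \<union> (\<lambda>m. - int m) ` {..nat N})"
      by (rule sum_mono2[OF _ sub]) auto
    also have "\<dots> \<le> sum ?g (int ` {..nat N}) + sum ?g ((\<lambda>m. - int m) ` {..nat N})"
      by (subst sum.union_inter[symmetric]) (auto intro: sum_nonneg)
    also have "\<dots> = sum f {..nat N} + sum f {..nat N}"
      by (subst (1 2) sum.reindex) (auto simp: inj_on_def f_def o_def)
    finally show "sum ?g {-N..N} \<le> 2 * suminf f"
      using le[of "nat N"] by linarith
  qed (use pos in simp)
qed

text \<open>Each coordinate \<open>x\<close> of \<open>p\<close> satisfies \<open>(1 + \<bar>x\<bar>)\<^sup>2 \<le> 4 qnorm p\<close>. Multiplying the four inequalities,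
  each raised to the power \<open>3/4\<close>, bounds \<open>1 / (qnorm p)\<^sup>3\<close> by a product of functions of the
  single coordinates, each with a convergent sum because \<open>3/2 > 1\<close>.\<close>

lemma sum_inverse_qnorm_cubed_bounded:
  obtains C where "C > 0"
    "\<And>P. finite P \<Longrightarrow> (\<And>p. p \<in> P \<Longrightarrow> qnorm p > 0) \<Longrightarrow> (\<Sum>p\<in>P. 1 / real_of_int (qnorm p) ^ 3) \<le> C"
proof -
  obtain C where C: "C > 0" "\<And>N. (\<Sum>n=-N..N. (1 + real_of_int \<bar>n\<bar>) powr (-3/2)) \<le> C"
    using sum_over_int_box_bounded by blast
  let ?g = "\<lambda>n::int. (1 + real_of_int \<bar>n\<bar>) powr (-3/2)"
  have rescale: "1 / t ^ 3 = 64 * (4 * t) powr (-3)" if "t > 0" for t :: real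
    using that by (simp add: powr_minus powr_numeral power_mult_distrib field_simps)
  show thesis
  proof (rule that[of "64 * C ^ 4"])
    fix P :: "(int \<times> int3) set"
    assume fin: "finite P" and pos: "\<And>p. p \<in> P \<Longrightarrow> qnorm p > 0"
    have bound: "1 / real_of_int (qnorm (a, b1, b2, b3)) ^ 3 \<le> 64 * (?g a * (?g b1 * (?g b2 * ?g b3)))"
      if "(a, b1, b2, b3) \<in> P" for a b1 b2 b3
    proof -
      let ?d = "real_of_int (qnorm (a, b1, b2, b3))"
      have d: "?d > 0"
        using pos[OF that] by (simp only: of_int_0_less_iff)
      have *: "(4 * ?d) powr (-3/4) \<le> ?g x" if x: "x \<in> {a, b1, b2, b3}" for x
      proof -
        have "real_of_int ((1 + \<bar>x\<bar>)\<^sup>2) \<le> real_of_int (4 * qnorm (a, b1, b2, b3))"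
          using coordinate_le_qnorm[OF pos[OF \<open>(a, b1, b2, b3) \<in> P\<close>] x] by (simp only: of_int_le_iff)
        then have "(1 + real_of_int \<bar>x\<bar>)\<^sup>2 \<le> 4 * ?d"
          by simp
        then have "(4 * ?d) powr (-3/4) \<le> ((1 + real_of_int \<bar>x\<bar>)\<^sup>2) powr (-3/4)"
          by (intro powr_mono2') (auto simp: add_pos_nonneg)
        also have "(1 + real_of_int \<bar>x\<bar>)\<^sup>2 = (1 + real_of_int \<bar>x\<bar>) powr 2"
          by (subst powr_numeral) auto
        also have "\<dots> powr (-3/4) = ?g x"
          by (simp only: powr_powr) simp
        finally show ?thesis .
      qed
      have split: "(4 * t) powr (-3) = (4 * t) powr (-3/4) * ((4 * t) powr (-3/4)
          * ((4 * t) powr (-3/4) * (4 * t) powr (-3/4)))" for t :: real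
        by (simp add: powr_add[symmetric])
      have "(4 * ?d) powr (-3) \<le> ?g a * (?g b1 * (?g b2 * ?g b3))"
        unfolding split by (intro mult_mono *) auto
      then show ?thesis
        unfolding rescale[OF d] by (rule mult_left_mono) simp
    qed
    have "\<exists>N. P \<subseteq> {-N..N} \<times> {-N..N} \<times> {-N..N} \<times> {-N..N}"
    proof -
      let ?m = "\<lambda>(a, b1, b2, b3). \<bar>a\<bar> + \<bar>b1\<bar> + \<bar>b2\<bar> + \<bar>b3::int\<bar>"
      have "bdd_above (?m ` P)"
        using fin by simp
      then obtain N where "\<forall>x \<in> ?m ` P. x \<le> N"
        unfolding bdd_above_def by blast
      then show ?thesis
        by (intro exI[of _ N]) fastforce
    qed
    then obtain N where N: "P \<subseteq> {-N..N} \<times> {-N..N} \<times> {-N..N} \<times> {-N..N}"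
      by blast
    let ?G = "\<lambda>(a, b1, b2, b3). ?g a * (?g b1 * (?g b2 * ?g b3))"
    have "(\<Sum>p\<in>P. 1 / real_of_int (qnorm p) ^ 3) \<le> (\<Sum>p\<in>P. 64 * ?G p)"
      using bound by (intro sum_mono) (auto split: prod.split)
    also have "\<dots> = 64 * sum ?G P"
      by (simp add: sum_distrib_left)
    also have "sum ?G P \<le> sum ?G ({-N..N} \<times> {-N..N} \<times> {-N..N} \<times> {-N..N})"
      by (rule sum_mono2[OF _ N]) (auto split: prod.split)
    also have "\<dots> = (\<Sum>n=-N..N. ?g n) ^ 4"
      by (simp add: sum.cartesian_product[symmetric] sum_distrib_left[symmetric]
          sum_distrib_right[symmetric] power4_eq_xxxx mult.assoc)
    also have "\<dots> \<le> C ^ 4"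
      by (rule power_mono[OF C(2)]) (auto intro: sum_nonneg)
    finally show "(\<Sum>p\<in>P. 1 / real_of_int (qnorm p) ^ 3) \<le> 64 * C ^ 4"
      by simp
  qed (use C(1) in simp)
qed

section \<open>Counting pairs with the same Gram matrix\<close>

type_synonym int3_triple = "int3 \<times> int3 \<times> int3"

definition gram_pairs :: "int \<Rightarrow> (int3_triple \<times> int3_triple) set" where
  "gram_pairs R = {((u, v, w), (u', v', w')). {u, v, w, u', v', w'} \<subseteq> box3 R \<and>
     det3 u v w \<noteq> 0 \<and> same_gram (u, v, w) (u', v', w')}"

lemma finite_gram_pairs: "finite (gram_pairs R)"
proof (rule finite_subset)
  let ?B = "box3 R \<times> box3 R \<times> box3 R"
  show "gram_pairs R \<subseteq> ?B \<times> ?B"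
    by (auto simp: gram_pairs_def)
qed auto

fun div3 :: "int3 \<Rightarrow> int \<Rightarrow> int3" where
  "div3 (x, y, z) d = (x div d, y div d, z div d)"

definition partner :: "int3 \<Rightarrow> int \<times> int3 \<Rightarrow> int3 \<Rightarrow> int3" where
  "partner s p v = flip s (div3 (euler_rodrigues p v) (qnorm p))"

text \<open>A pair is determined by its first triple, a sign pattern and a quaternion, and the first triple
  consists of vectors of the coincidence lattice.\<close>

lemma gram_pairs_subset:
  assumes "R \<ge> 0"
  shows "gram_pairs R \<subseteq> (\<Union>(s, p) \<in> signs \<times> full_rank_quaternions R.
     (\<lambda>(u, v, w). ((u, v, w), (partner s p u, partner s p v, partner s p w))) `
       ((coincidence_lattice p \<inter> box3 R) \<times> (coincidence_lattice p \<inter> box3 R) \<times>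
        (coincidence_lattice p \<inter> box3 R)))"
proof
  fix x
  assume x: "x \<in> gram_pairs R"
  obtain u v w u' v' w' where eq: "x = ((u, v, w), (u', v', w'))"
    by (metis prod.exhaust)
  have nz: "det3 u v w \<noteq> 0" and gram: "same_gram (u, v, w) (u', v', w')"
    and box: "{u, v, w} \<subseteq> box3 R"
    using x by (auto simp: eq gram_pairs_def)
  obtain s p where s: "s \<in> signs" and p: "primitive p"
    and rot: "scale (qnorm p) (flip s u') = euler_rodrigues p u"
      "scale (qnorm p) (flip s v') = euler_rodrigues p v"
      "scale (qnorm p) (flip s w') = euler_rodrigues p w"
    using same_gram_rational_isometry[OF nz gram] by blast
  have d: "qnorm p > 0"
    by (rule qnorm_pos[OF p])
  have dv: "dvd3 (qnorm p) (scale (qnorm p) z)" and quot: "div3 (scale (qnorm p) z) (qnorm p) = z" for z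
    using d by (cases z; simp)+
  have lat: "{u, v, w} \<subseteq> coincidence_lattice p"
    using dv[of "flip s u'"] dv[of "flip s v'"] dv[of "flip s w'"]
    by (simp add: coincidence_lattice_def rot)
  then have "p \<in> full_rank_quaternions R"
    using p nz box unfolding full_rank_quaternions_def by blast
  moreover have "partner s p u = u'" "partner s p v = v'" "partner s p w = w'"
    by (simp_all add: partner_def rot[symmetric] quot flip_flip[OF s])
  ultimately show "x \<in> (\<Union>(s, p) \<in> signs \<times> full_rank_quaternions R.
     (\<lambda>(u, v, w). ((u, v, w), (partner s p u, partner s p v, partner s p w))) `
       ((coincidence_lattice p \<inter> box3 R) \<times> (coincidence_lattice p \<inter> box3 R) \<times>
        (coincidence_lattice p \<inter> box3 R)))"
    using s lat box unfolding eq
    by (intro UN_I[of "(s, p)"]) (auto intro!: image_eqI[of _ _ "(u, v, w)"])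
qed

lemma card_gram_pairs_le:
  obtains C :: real where "C > 0" "\<And>R. R \<ge> 1 \<Longrightarrow> real (card (gram_pairs R)) \<le> C * real_of_int R ^ 9"
proof -
  obtain C where C: "C > 0"
    "\<And>P. finite P \<Longrightarrow> (\<And>p. p \<in> P \<Longrightarrow> qnorm p > 0) \<Longrightarrow> (\<Sum>p\<in>P. 1 / real_of_int (qnorm p) ^ 3) \<le> C"
    using sum_inverse_qnorm_cubed_bounded by blast
  show thesis
  proof (rule that[of "8 * (64 * 9 ^ 9) * C"])
    fix R :: int
    assume R: "R \<ge> 1"
    let ?K = "\<lambda>p. coincidence_lattice p \<inter> box3 R"
    let ?M = "4 * (8 * real_of_int R + 1) ^ 3"
    have fin: "finite (full_rank_quaternions R)"
      using R by (intro finite_full_rank_quaternions) simp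
    let ?A = "\<lambda>(s, p). (\<lambda>(u, v, w). ((u, v, w), (partner s p u, partner s p v, partner s p w))) ` (?K p \<times> ?K p \<times> ?K p)"
    have "card (gram_pairs R) \<le> card (\<Union>x \<in> signs \<times> full_rank_quaternions R. ?A x)"
      using gram_pairs_subset[of R] R fin finite_signs
      by (intro card_mono) (auto split: prod.split)
    also have "\<dots> \<le> (\<Sum>x \<in> signs \<times> full_rank_quaternions R. card (?A x))"
      using fin finite_signs by (intro card_UN_le) simp
    also have "\<dots> \<le> (\<Sum>x \<in> signs \<times> full_rank_quaternions R. card (?K (snd x)) ^ 3)"
    proof (rule sum_mono)
      fix x :: "int3 \<times> (int \<times> int3)"
      obtain s p where x: "x = (s, p)"
        by (cases x)
      have "card (?A (s, p)) \<le> card (?K p \<times> ?K p \<times> ?K p)"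
        unfolding prod.case by (rule card_image_le) simp
      then show "card (?A x) \<le> card (?K (snd x)) ^ 3"
        unfolding x by (simp add: card_cartesian_product power3_eq_cube mult.assoc)
    qed
    also have "\<dots> = (\<Sum>s\<in>signs. \<Sum>p\<in>full_rank_quaternions R. card (?K p) ^ 3)"
      by (simp only: sum.cartesian_product case_prod_unfold)
    also have "\<dots> = 8 * (\<Sum>p\<in>full_rank_quaternions R. card (?K p) ^ 3)"
      by (simp add: card_signs)
    finally have "real (card (gram_pairs R)) \<le> real (8 * (\<Sum>p\<in>full_rank_quaternions R. card (?K p) ^ 3))"
      by (simp only: of_nat_le_iff)
    also have "\<dots> = 8 * (\<Sum>p\<in>full_rank_quaternions R. real (card (?K p)) ^ 3)"
      by simp
    also have "\<dots> \<le> 8 * (\<Sum>p\<in>full_rank_quaternions R. ?M ^ 3 * (1 / real_of_int (qnorm p) ^ 3))"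
    proof (intro mult_left_mono sum_mono)
      fix p
      assume p: "p \<in> full_rank_quaternions R"
      have q: "real_of_int (qnorm p) > 0"
        using full_rank_quaternions_bounds(2)[OF p] R by (simp only: of_int_0_less_iff)
      have "real_of_int (int (card (?K p)) * qnorm p) \<le> real_of_int (4 * (8 * R + 1) ^ 3)"
        using full_rank_quaternions_bounds(1)[OF p] R by (simp only: of_int_le_iff)
      then have "real (card (?K p)) * real_of_int (qnorm p) \<le> ?M"
        by simp
      then have "real (card (?K p)) \<le> ?M / real_of_int (qnorm p)"
        using q by (simp add: field_simps)
      then have "real (card (?K p)) ^ 3 \<le> (?M / real_of_int (qnorm p)) ^ 3"
        by (rule power_mono) simp
      then show "real (card (?K p)) ^ 3 \<le> ?M ^ 3 * (1 / real_of_int (qnorm p) ^ 3)"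
        by (simp add: power_divide)
    qed simp
    also have "\<dots> = 8 * (?M ^ 3 * (\<Sum>p\<in>full_rank_quaternions R. 1 / real_of_int (qnorm p) ^ 3))"
      by (simp only: sum_distrib_left)
    also have "\<dots> \<le> 8 * ((4 * (9 * real_of_int R) ^ 3) ^ 3 * C)"
    proof (intro mult_left_mono mult_mono power_mono)
      show "(\<Sum>p\<in>full_rank_quaternions R. 1 / real_of_int (qnorm p) ^ 3) \<le> C"
        using full_rank_quaternions_bounds(2) R by (intro C(2) fin) auto
      show "0 \<le> (\<Sum>p\<in>full_rank_quaternions R. 1 / real_of_int (qnorm p) ^ 3)"
        using full_rank_quaternions_bounds(2) R by (intro sum_nonneg) (simp add: less_imp_le)
    qed (use R in auto)
    also have "\<dots> = 8 * (64 * 9 ^ 9) * C * real_of_int R ^ 9"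
      by (simp add: power_mult_distrib power_mult[symmetric])
    finally show "real (card (gram_pairs R)) \<le> 8 * (64 * 9 ^ 9) * C * real_of_int R ^ 9" .
  qed (use C(1) in simp)
qed

text \<open>Cauchy-Schwarz for the sizes of the fibres of \<open>f\<close>.\<close>

lemma card_squared_le_card_image_times_collisions:
  assumes "finite A"
  shows "(card A)\<^sup>2 \<le> card (f ` A) * card {(x, y) \<in> A \<times> A. f x = f y}"
proof -
  let ?r = "\<lambda>c. card {x \<in> A. f x = c}"
  have "card A = (\<Sum>c\<in>f ` A. ?r c)"
    using sum.image_gen[OF assms, of "\<lambda>_. 1::nat" f] by simp
  moreover have "card {(x, y) \<in> A \<times> A. f x = f y} = (\<Sum>c\<in>f ` A. (?r c)\<^sup>2)"
  proof -
    have "{(x, y) \<in> A \<times> A. f x = f y} = (SIGMA x:A. {y \<in> A. f y = f x})"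
      by auto
    then have "card {(x, y) \<in> A \<times> A. f x = f y} = (\<Sum>x\<in>A. ?r (f x))"
      using assms by (simp add: card_SigmaI)
    also have "\<dots> = (\<Sum>c\<in>f ` A. \<Sum>x\<in>{x \<in> A. f x = c}. ?r (f x))"
      by (rule sum.image_gen[OF assms])
    also have "\<dots> = (\<Sum>c\<in>f ` A. (?r c)\<^sup>2)"
      by (intro sum.cong refl) (simp add: power2_eq_square)
    finally show ?thesis .
  qed
  moreover have "(\<Sum>c\<in>f ` A. real (?r c))\<^sup>2 \<le> real (card (f ` A)) * (\<Sum>c\<in>f ` A. (real (?r c))\<^sup>2)"
    using sum_squared_le_sum_of_squares[of "\<lambda>c. real (?r c)" "f ` A"] by (simp add: mult.commute)
  then have "real ((\<Sum>c\<in>f ` A. ?r c)\<^sup>2) \<le> real (card (f ` A) * (\<Sum>c\<in>f ` A. (?r c)\<^sup>2))"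
    by simp
  ultimately show ?thesis
    by (simp only: of_nat_le_iff)
qed

section \<open>Congruence of lattice tetrahedra\<close>

fun embed :: "int3 \<Rightarrow> real ^ 3" where
  "embed (x, y, z) = vector [of_int x, of_int y, of_int z]"

lemma embed_diff: "embed (v - w) = embed v - embed w"
  by (cases v; cases w) (simp add: vec_eq_iff forall_3)

lemma embed_0: "embed 0 = 0"
  by (simp add: zero_prod_def vec_eq_iff forall_3)

lemma inj_embed: "inj embed"
proof (rule injI)
  fix v w
  assume "embed v = embed w"
  then show "v = w"
    by (cases v; cases w) (simp add: vec_eq_iff forall_3)
qed

lemma inner_embed: "embed v \<bullet> embed w = of_int (dot v w)"
  by (cases v; cases w) (simp add: inner_vec_def sum_3)

lemma det_embed: "det (vector [embed u, embed v, embed w] :: real ^ 3 ^ 3) = of_int (det3 u v w)"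
  by (cases u; cases v; cases w) (simp add: det_3 det3_def algebra_simps)

fun vertices :: "int3_triple \<Rightarrow> int3 set" where
  "vertices (u, v, w) = {0, u, v, w}"

lemma vertices_affine_independent:
  assumes nz: "det3 u v w \<noteq> 0"
  shows "card (vertices (u, v, w)) = 4" and "\<not> affine_dependent (embed ` vertices (u, v, w))"
proof -
  have "det3 0 v w = 0" "det3 u 0 w = 0" "det3 u v 0 = 0" "det3 u u w = 0" "det3 u v u = 0"
    "det3 u v v = 0"
    by (cases u; cases v; cases w; simp add: det3_def zero_prod_def algebra_simps)+
  then have ne: "u \<noteq> 0" "v \<noteq> 0" "w \<noteq> 0" "u \<noteq> v" "u \<noteq> w" "v \<noteq> w"
    using nz by auto
  then show "card (vertices (u, v, w)) = 4"
    by simp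
  let ?A = "vector [embed u, embed v, embed w] :: real ^ 3 ^ 3"
  have "rows ?A = range (\<lambda>i. ?A $ i)"
    by (auto simp: rows_def row_def)
  then have "rows ?A = {embed u, embed v, embed w}"
    by (simp add: UNIV_3)
  moreover have "det ?A \<noteq> 0"
    using nz by (simp add: det_embed)
  ultimately have "independent {embed u, embed v, embed w}"
    using det_dependent_rows[of ?A] by (auto simp: dependent_vec_eq)
  moreover have "0 \<notin> {embed u, embed v, embed w}"
    using ne inj_embed embed_0 by (metis injD insertE singletonD)
  ultimately show "\<not> affine_dependent (embed ` vertices (u, v, w))"
    by (simp add: embed_0 affine_dependent_iff_dependent)
qed

text \<open>An isometry is affine, so it maps the hull of \<open>V\<close> to the hull of the image of \<open>V\<close>; the vertices of
  a simplex are recovered from it as its extreme points.\<close>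

lemma congruent_hulls_vertices:
  fixes V W :: "(real ^ 3) set"
  assumes cong: "congruent_sets (convex hull V) (convex hull W)"
    and V: "finite V" and W: "\<not> affine_dependent W" and card: "card V = card W"
  obtains g a where "orthogonal_transformation g" "(\<lambda>x. a + g x) ` V = W"
proof -
  obtain f where iso: "\<And>x y. dist (f x) (f y) = dist x y" and img: "f ` (convex hull V) = convex hull W"
    using cong by (auto simp: congruent_sets_def)
  define g where "g x = f x - f 0" for x
  have "dist (g x) (g y) = dist x y" for x y
    using iso[of x y] by (simp add: g_def dist_norm)
  then have orth: "orthogonal_transformation g"
    by (simp add: orthogonal_transformation_isometry g_def)
  have f: "f = (\<lambda>x. f 0 + g x)"
    by (simp add: g_def)
  have fim: "f ` S = (+) (f 0) ` g ` S" for S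
    by (subst f) (simp add: image_image)
  have "convex hull W = convex hull (f ` V)"
    using orth unfolding img[symmetric] fim
    by (simp add: convex_hull_translation convex_hull_linear_image orthogonal_transformation_linear)
  then have "W \<subseteq> f ` V"
    using extreme_point_of_convex_hull_affine_independent[OF W]
      extreme_point_of_convex_hull[of _ "f ` V"] by auto
  moreover have "card (f ` V) \<le> card W"
    using card card_image_le[OF V] by metis
  ultimately have "f ` V = W"
    using V card_seteq[of "f ` V" W] by auto
  with f that[OF orth, of "f 0"] show thesis
    by metis
qed

definition differences :: "'a :: minus set \<Rightarrow> 'a set" where
  "differences S = (\<lambda>(x, y). x - y) ` (S \<times> S)"

lemma card_differences_vertices: "finite (differences (vertices t))"
  "card (differences (vertices t)) \<le> 16"
proof -
  obtain u v w where t: "t = (u, v, w)"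
    by (cases t)
  have fin: "finite (vertices t)"
    by (simp add: t)
  then show "finite (differences (vertices t))"
    by (simp add: differences_def)
  have "card (vertices t) \<le> 4"
    by (simp add: t card_insert_if)
  then have "card (vertices t) * card (vertices t) \<le> 4 * 4"
    by (rule mult_le_mono) fact
  moreover have "card (differences (vertices t)) \<le> card (vertices t \<times> vertices t)"
    unfolding differences_def by (rule card_image_le) (simp add: fin)
  ultimately show "card (differences (vertices t)) \<le> 16"
    by (simp add: card_cartesian_product)
qed

text \<open>The congruence may permute the vertices. It carries the edges \<open>u, v, w\<close> at the origin to edges at
  the image of the origin, and these form the triple \<open>t\<close>. The origin is itself a vertex of the second
  tetrahedron, so every vertex of it is a difference of two points of \<open>vertices t\<close>. Hence \<open>t\<close>
  leaves only boundedly many choices for \<open>u', v', w'\<close>, without a case distinction over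
  permutations.\<close>

lemma congruent_tetrahedra_same_gram:
  assumes nz: "det3 u v w \<noteq> 0" "det3 u' v' w' \<noteq> 0"
    and box: "vertices (u', v', w') \<subseteq> {0..n} \<times> {0..n} \<times> {0..n}" and ubox: "{u, v, w} \<subseteq> box3 n"
    and cong: "congruent_sets (convex hull (embed ` vertices (u, v, w)))
      (convex hull (embed ` vertices (u', v', w')))"
  obtains t where "((u, v, w), t) \<in> gram_pairs n" "{u', v', w'} \<subseteq> differences (vertices t)"
proof -
  let ?V = "vertices (u, v, w)" and ?W = "vertices (u', v', w')"
  have card: "card (embed ` S) = card S" for S
    using inj_embed by (simp add: card_image inj_on_subset)
  obtain g a where g: "orthogonal_transformation g"
    and img: "(\<lambda>x. a + g x) ` embed ` ?V = embed ` ?W"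
    using congruent_hulls_vertices[OF cong _ vertices_affine_independent(2)[OF nz(2)]]
      vertices_affine_independent(1)[OF nz(1)] vertices_affine_independent(1)[OF nz(2)] card
    by (metis finite.emptyI finite.insertI finite_imageI vertices.simps)
  have "\<exists>y \<in> ?W. a + g (embed x) = embed y" if "x \<in> ?V" for x
    using img that by blast
  then obtain h where h: "\<And>x. x \<in> ?V \<Longrightarrow> h x \<in> ?W" "\<And>x. x \<in> ?V \<Longrightarrow> a + g (embed x) = embed (h x)"
    by metis
  have a: "a = embed (h 0)"
    using h(2)[of 0] g by (simp add: embed_0 orthogonal_transformation_linear linear_0)
  define k where "k x = h x - h 0" for x
  have k: "embed (k x) = g (embed x)" if "x \<in> ?V" for x
    using h(2)[OF that] by (simp add: k_def embed_diff a[symmetric] diff_eq_eq add.commute)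
  have dotk: "dot (k x) (k y) = dot x y" if "x \<in> ?V" "y \<in> ?V" for x y
  proof -
    have "real_of_int (dot (k x) (k y)) = embed x \<bullet> embed y"
      using g that by (simp add: inner_embed[symmetric] k orthogonal_transformation_def)
    then show ?thesis
      by (simp add: inner_embed)
  qed
  have box_diff: "x - y \<in> box3 n" if "x \<in> ?W" "y \<in> ?W" for x y
  proof -
    have "x \<in> {0..n} \<times> {0..n} \<times> {0..n}" "y \<in> {0..n} \<times> {0..n} \<times> {0..n}"
      using that box by blast+
    then show ?thesis
      by (cases x; cases y) (simp add: box3_def)
  qed
  let ?t = "(k u, k v, k w)"
  have "{k u, k v, k w} \<subseteq> box3 n"
    using h(1) by (simp add: k_def box_diff)
  moreover have "same_gram (u, v, w) ?t"
    by (simp add: dotk)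
  ultimately have 1: "((u, v, w), ?t) \<in> gram_pairs n"
    using nz(1) ubox by (simp add: gram_pairs_def)
  have verts: "vertices ?t = k ` ?V"
    by (auto simp: k_def)
  have onto: "\<exists>x \<in> ?V. y = h x" if "y \<in> ?W" for y
  proof -
    have "embed y \<in> (\<lambda>x. a + g x) ` embed ` ?V"
      using that by (simp add: img del: vertices.simps)
    then obtain x where "x \<in> ?V" "embed y = embed (h x)"
      using h(2) by (auto simp del: vertices.simps)
    then show ?thesis
      using inj_embed by (auto dest: injD simp del: vertices.simps)
  qed
  obtain o' where o: "o' \<in> ?V" "h o' = 0"
    using onto[of 0] by (metis insertI1 vertices.simps)
  have "y \<in> differences (vertices ?t)" if "y \<in> ?W" for y
  proof -
    obtain x where "x \<in> ?V" "y = h x"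
      using onto[OF \<open>y \<in> ?W\<close>] by blast
    then have "y = k x - k o'" "k x \<in> vertices ?t" "k o' \<in> vertices ?t"
      unfolding verts using o by (simp_all add: k_def del: vertices.simps)
    then show ?thesis
      unfolding differences_def by blast
  qed
  then have "{u', v', w'} \<subseteq> differences (vertices ?t)"
    by simp
  with 1 show thesis
    by (rule that)
qed

text \<open>Odd entries on the diagonal and even entries elsewhere: the determinant is then odd, in particular
  nonzero, while a positive proportion of all triples is kept.\<close>

definition parity_box :: "nat \<Rightarrow> int3_triple set" where
  "parity_box k =
    (let ev = (\<lambda>i. 2 * i) ` {0..<int k}; od = (\<lambda>i. 2 * i + 1) ` {0..<int k}
     in (od \<times> ev \<times> ev) \<times> (ev \<times> od \<times> ev) \<times> (ev \<times> ev \<times> od))"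

lemma card_parity_box: "card (parity_box k) = k ^ 9"
proof -
  have "card ((\<lambda>i. 2 * i) ` {0..<int k}) = k" "card ((\<lambda>i. 2 * i + 1) ` {0..<int k}) = k"
    by (subst card_image; simp add: inj_on_def)+
  then show ?thesis
    by (simp add: parity_box_def Let_def card_cartesian_product power_numeral_reduce)
qed

lemma parity_box_nonsingular: "(u, v, w) \<in> parity_box k \<Longrightarrow> det3 u v w \<noteq> 0"
proof -
  assume mem: "(u, v, w) \<in> parity_box k"
  obtain a b c d e f g h i where eq: "u = (a, b, c)" "v = (d, e, f)" "w = (g, h, i)"
    by (metis prod.exhaust)
  have "odd a" "odd e" "odd i" "even b" "even c" "even d" "even f" "even g" "even h"
    using mem by (auto simp: parity_box_def Let_def eq)
  then have "odd (det3 u v w)"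
    by (simp add: det3_def eq)
  then show ?thesis
    by auto
qed

lemma parity_box_bounds:
  assumes "(u, v, w) \<in> parity_box k"
  shows "vertices (u, v, w) \<subseteq> {0..2 * int k - 1} \<times> {0..2 * int k - 1} \<times> {0..2 * int k - 1}"
  using assms by (cases u; cases v; cases w) (auto simp: parity_box_def Let_def zero_prod_def)

definition tetrahedron :: "int3_triple \<Rightarrow> (real ^ 3) set" where
  "tetrahedron t = convex hull (embed ` vertices t)"

definition congruence_class :: "real \<Rightarrow> int3_triple \<Rightarrow> (real ^ 3) set set" where
  "congruence_class q t = congruence_on (tetrahedra (lattice_cube q)) `` {tetrahedron t}"

lemma parity_box_tetrahedra:
  assumes t: "t \<in> parity_box k" and q: "2 * real k - 1 \<le> q"
  shows "tetrahedron t \<in> tetrahedra (lattice_cube q)"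
proof -
  obtain u v w where eq: "t = (u, v, w)"
    by (cases t)
  note t = t[unfolded eq]
  have "embed x \<in> lattice_cube q" if "x \<in> vertices (u, v, w)" for x
  proof -
    obtain a b c where x: "x = (a, b, c)"
      by (cases x)
    have "{a, b, c} \<subseteq> {0..2 * int k - 1}"
      using parity_box_bounds[OF t] that by (auto simp: x simp del: vertices.simps)
    moreover have "real_of_int z \<le> q" if "z \<le> 2 * int k - 1" for z
    proof -
      have "real_of_int z \<le> real_of_int (2 * int k - 1)"
        using that by (simp only: of_int_le_iff)
      then show ?thesis
        using q by simp
    qed
    ultimately show ?thesis
      by (simp add: lattice_cube_def forall_3 x)
  qed
  moreover have "card (embed ` vertices (u, v, w)) = 4"
    using vertices_affine_independent(1)[OF parity_box_nonsingular[OF t]] inj_embed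
    by (simp add: card_image inj_on_subset del: vertices.simps)
  ultimately show ?thesis
    using vertices_affine_independent(2)[OF parity_box_nonsingular[OF t]]
    unfolding tetrahedra_def tetrahedron_def eq by blast
qed

lemma card_collisions_le:
  assumes k: "k \<ge> 1" and q: "2 * real k - 1 \<le> q"
  shows "card {(s, t) \<in> parity_box k \<times> parity_box k. congruence_class q s = congruence_class q t}
    \<le> 4096 * card (gram_pairs (2 * int k))"
    (is "card ?P \<le> _")
proof -
  let ?n = "2 * int k"
  let ?D = "\<lambda>r. differences (vertices r)"
  let ?A = "\<lambda>(s, r). {s} \<times> (?D r \<times> ?D r \<times> ?D r)"
  have "?P \<subseteq> (\<Union>x \<in> gram_pairs ?n. ?A x)"
  proof
    fix x
    assume "x \<in> ?P"
    then obtain s t where x: "x = (s, t)" and s: "s \<in> parity_box k" and t: "t \<in> parity_box k"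
      and eq: "congruence_class q s = congruence_class q t"
      by auto
    obtain u v w u' v' w' where st: "s = (u, v, w)" "t = (u', v', w')"
      by (metis prod.exhaust)
    have "(tetrahedron s, tetrahedron t) \<in> congruence_on (tetrahedra (lattice_cube q))"
      using eq parity_box_tetrahedra[OF t q]
      by (intro eq_equiv_class[OF _ equiv_congruence_on]) (auto simp: congruence_class_def)
    then have cong: "congruent_sets (convex hull (embed ` vertices (u, v, w)))
        (convex hull (embed ` vertices (u', v', w')))"
      by (simp add: congruence_on_def tetrahedron_def st)
    have "{0..2 * int k - 1} \<subseteq> {0..?n}" "{0..2 * int k - 1} \<subseteq> {- ?n..?n}"
      by auto
    then have box: "vertices (u', v', w') \<subseteq> {0..?n} \<times> {0..?n} \<times> {0..?n}"
      "vertices (u, v, w) \<subseteq> box3 ?n"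
      using parity_box_bounds[OF s[unfolded st]] parity_box_bounds[OF t[unfolded st]]
      unfolding box3_def by blast+
    then have "{u, v, w} \<subseteq> box3 ?n"
      by simp
    then obtain r where r: "((u, v, w), r) \<in> gram_pairs ?n" "{u', v', w'} \<subseteq> ?D r"
      using congruent_tetrahedra_same_gram[OF parity_box_nonsingular[OF s[unfolded st]]
          parity_box_nonsingular[OF t[unfolded st]] box(1) _ cong] by blast
    then show "x \<in> (\<Union>x \<in> gram_pairs ?n. ?A x)"
      by (intro UN_I[of "((u, v, w), r)"]) (auto simp: x st)
  qed
  then have "card ?P \<le> card (\<Union>x \<in> gram_pairs ?n. ?A x)"
    using finite_gram_pairs card_differences_vertices(1)
    by (intro card_mono) (auto split: prod.split)
  also have "\<dots> \<le> (\<Sum>x \<in> gram_pairs ?n. card (?A x))"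
    by (rule card_UN_le[OF finite_gram_pairs])
  also have "\<dots> \<le> (\<Sum>x \<in> gram_pairs ?n. 4096)"
  proof (rule sum_mono)
    fix x :: "int3_triple \<times> int3_triple"
    obtain s r where x: "x = (s, r)"
      by (cases x)
    have "card (?D r) * (card (?D r) * card (?D r)) \<le> 16 * (16 * 16)"
      by (intro mult_le_mono card_differences_vertices)
    then show "card (?A x) \<le> 4096"
      by (simp add: x card_cartesian_product)
  qed
  also have "\<dots> = 4096 * card (gram_pairs ?n)"
    by simp
  finally show ?thesis .
qed

section \<open>The lower bound\<close>

lemma card_T3_ge:
  obtains c :: real where "c > 0"
    "\<And>q. q > 1 \<Longrightarrow> real (card (T3 (lattice_cube q))) \<ge> c * q ^ 9"
proof -
  obtain C where C: "C > 0" "\<And>R. R \<ge> 1 \<Longrightarrow> real (card (gram_pairs R)) \<le> C * real_of_int R ^ 9"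
    using card_gram_pairs_le by blast
  define B where "B = 4096 * C * 2 ^ 9"
  have B: "B > 0"
    using C(1) by (simp add: B_def)
  show thesis
  proof (rule that[of "1 / (B * 3 ^ 9)"])
    fix q :: real
    assume q: "q > 1"
    \<comment> \<open>the largest size for which the parity box fits into the cube\<close>
    define k where "k = nat \<lfloor>(q + 1) / 2\<rfloor>"
    have fl: "\<lfloor>(q + 1) / 2\<rfloor> \<ge> 1"
      using q by simp
    then have k: "k \<ge> 1"
      unfolding k_def by linarith
    have rk: "real k = of_int \<lfloor>(q + 1) / 2\<rfloor>"
      using fl by (simp add: k_def)
    have "real k \<ge> 1"
      using k by simp
    moreover have "real k \<le> (q + 1) / 2" "(q + 1) / 2 < real k + 1"
      using floor_correct[of "(q + 1) / 2"] unfolding rk by simp_all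
    ultimately have kq: "2 * real k - 1 \<le> q" "q \<le> 3 * real k"
      by simp_all
    let ?F = "congruence_class q ` parity_box k"
    have fin: "finite (parity_box k)"
      by (simp add: parity_box_def Let_def)
    have "?F \<subseteq> T3 (lattice_cube q)"
      using parity_box_tetrahedra[OF _ kq(1)]
      unfolding T3_def congruence_class_def by (auto intro: quotientI)
    then have le: "card ?F \<le> card (T3 (lattice_cube q))"
      by (rule card_mono[OF finite_T3[OF finite_lattice_cube]])
    have "(card (parity_box k))\<^sup>2 \<le> card ?F *
        card {(s, t) \<in> parity_box k \<times> parity_box k. congruence_class q s = congruence_class q t}"
      by (rule card_squared_le_card_image_times_collisions[OF fin])
    also have "\<dots> \<le> card ?F * (4096 * card (gram_pairs (2 * int k)))"
      by (intro mult_left_mono card_collisions_le k kq) simp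
    finally have "real ((card (parity_box k))\<^sup>2) \<le> real (card ?F * (4096 * card (gram_pairs (2 * int k))))"
      by (simp only: of_nat_le_iff)
    then have "(real k ^ 9)\<^sup>2 \<le> real (card ?F) * (4096 * real (card (gram_pairs (2 * int k))))"
      by (simp add: card_parity_box)
    also have "\<dots> \<le> real (card ?F) * (4096 * (C * real_of_int (2 * int k) ^ 9))"
      using k by (intro mult_left_mono C(2)) auto
    also have "\<dots> = real (card ?F) * B * real k ^ 9"
      by (simp add: B_def power_mult_distrib)
    finally have "real k ^ 9 * real k ^ 9 \<le> real (card ?F) * B * real k ^ 9"
      by (simp add: power2_eq_square)
    then have main: "real k ^ 9 \<le> real (card ?F) * B"
      by (rule mult_right_le_imp_le) (use k in simp)
    have "q ^ 9 \<le> (3 * real k) ^ 9"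
      using kq q by (intro power_mono) auto
    also have "\<dots> = 3 ^ 9 * real k ^ 9"
      by (rule power_mult_distrib)
    also have "\<dots> \<le> 3 ^ 9 * (real (card ?F) * B)"
      by (rule mult_left_mono[OF main]) simp
    finally have "1 / (B * 3 ^ 9) * q ^ 9 \<le> real (card ?F)"
      using B by (simp add: field_simps)
    also have "\<dots> \<le> real (card (T3 (lattice_cube q)))"
      using le by simp
    finally show "1 / (B * 3 ^ 9) * q ^ 9 \<le> real (card (T3 (lattice_cube q)))" .
  qed (use B in simp)
qed

theorem theorem3p2:
  shows "\<forall>\<epsilon>::real. \<epsilon> > 0 \<longrightarrow>
    (\<exists>c::real. c > 0 \<and>
      (\<forall>q::real. q > 1 \<longrightarrow>
        real (card (T3 (lattice_cube q))) \<ge> c * q powr (9 - \<epsilon>)))"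
proof (intro allI impI)
  fix \<epsilon> :: real
  assume "\<epsilon> > 0"
  obtain c :: real where c: "c > 0"
    "\<And>q. q > 1 \<Longrightarrow> real (card (T3 (lattice_cube q))) \<ge> c * q ^ 9"
    using card_T3_ge by blast
  have "real (card (T3 (lattice_cube q))) \<ge> c * q powr (9 - \<epsilon>)" if "q > 1" for q
  proof -
    have "q powr (9 - \<epsilon>) \<le> q powr 9"
      using \<open>\<epsilon> > 0\<close> that by (intro powr_mono) auto
    also have "q powr 9 = q ^ 9"
      using that by (simp add: powr_numeral)
    finally have "c * q powr (9 - \<epsilon>) \<le> c * q ^ 9"
      using c(1) by simp
    with c(2)[OF that] show ?thesis
      by linarith
  qed
  with c(1) show "\<exists>c>0. \<forall>q>1. real (card (T3 (lattice_cube q))) \<ge> c * q powr (9 - \<epsilon>)"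
    by blast
qed

end
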